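(* Let $X$ be a time-homogeneous Markov chain of order $m\ge 1$ on a finite alphabet $A$, with transition kernel $p$, first-order transition matrix $\mathbb{P}$ on $A^m$, skeleton of order $K$, skeleton matrix $\mathbb{M}$, and set $\mathcal{A}\subseteq A^m$ as defined in the context. If $\mathbb{M}$ has exactly $N\ge 1$ closed classes $\mathcal{C}_1,\dots,\mathcal{C}_N\subseteq A^K$, then $\mathbb{P}$ has exactly $N$ recurrent classes $\mathcal{R}_1,\dots,\mathcal{R}_N\subseteq A^m$, and they satisfy $$\mathcal{R}_i=\{\mathbf{y}\mathbf{z}\in A^m:\ \mathbf{y}\in\mathcal{C}_i\ \text{and}\ \mathbf{y}\mathbf{z}\in\mathcal{A}\}\qquad\text{for } i\in\{1,\dots,N\}$$ (here $\mathbf{y}\in A^K$ and $\mathbf{z}\in A^{m-K}$). Moreover, for each $i\in\{1,\dots,N\}$, the period of $\mathcal{C}_i$ (for $\mathbb{M}$) is equal to the period of $\mathcal{R}_i$ (for $\mathbb{P}$).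
   Context: Words: $A$ is a finite set. For $\mathbf{x}\in A^k$, $\mathbf{x}_i^j=(x_i,\dots,x_j)$ for $1\le i\le j\le k$, and $\mathbf{x}_i^j=\mathbf{e}$ (the empty word) if $i>j$; $A^0=\{\mathbf{e}\}$. Juxtaposition $\mathbf{x}\mathbf{y}$ denotes concatenation. Kernel: $p:A^m\times A\to[0,1]$, $p(\mathbf{x},a)=P(X_{n+1}=a\mid X_n=x_m,X_{n-1}=x_{m-1},\dots,X_{n-m+1}=x_1)$, so $x_m$ is the most recent symbol, and $\sum_{a\in A}p(\mathbf{x},a)=1$. The stochastic matrix $\mathbb{P}$ on $A^m$ is given by $\mathbb{P}(\mathbf{x},\mathbf{x}_2^m a)=p(\mathbf{x},a)$ for $\mathbf{x}\in A^m$, $a\in A$, all other entries being $0$. Skeleton order: for $\mathbf{x}\in A^m$ and $a\in A$, $$\tau(\mathbf{x},a)=\min\{i\ge 0:\ p(\mathbf{y}\mathbf{x}_{m-i}^m,a)=0\ \forall \mathbf{y}\in A^{m-i-1},\ \text{or}\ p(\mathbf{y}\mathbf{x}_{m-i}^m,a)>0\ \forall \mathbf{y}\in A^{m-i-1}\},$$ $\tau_{\mathbf{x}}=\sup_{a\in A}\tau(\mathbf{x},a)$. The skeleton of $p$ is $\mathcal{S}=\bigcup_{\mathbf{x}\in A^m}\{\mathbf{x}_{m-\tau_{\mathbf{x}}}^m\}$ and its order is $K=1+\sup_{\mathbf{x}\in A^m}\tau_{\mathbf{x}}\in\{1,\dots,m\}$. Skeleton matrix: $\mathbb{M}$ is the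 $\{0,1\}$-matrix indexed by $A^K\times A^K$ with $\mathbb{M}(\mathbf{u},\mathbf{v})=1$ if $(\mathbf{u},\mathbf{v})=(\mathbf{x}_1^K,\mathbf{x}_2^K a)$ for some $\mathbf{x}\in A^K$, $a\in A$ such that $p(\mathbf{y}\mathbf{x}_1^K,a)>0$ for all $\mathbf{y}\in A^{m-K}$, and $\mathbb{M}(\mathbf{u},\mathbf{v})=0$ otherwise. The set $\mathcal{A}$: if $K=m$, $\mathcal{A}=A^m$; if $K<m$, $\mathcal{A}$ is the set of $\mathbf{x}\in A^m$ such that $\mathbb{M}(\mathbf{x}_1^K,\mathbf{x}_2^{K+1})\,\mathbb{M}(\mathbf{x}_2^{K+1},\mathbf{x}_3^{K+2})\cdots\mathbb{M}(\mathbf{x}_{m-K}^{m-1},\mathbf{x}_{m-K+1}^m)=1$. Classes: powers of $\{0,1\}$-matrices are Boolean ($1+1=1$). For a binary matrix $B$ on a finite set $E$, communicating classes and periods are defined as for stochastic matrices (accessibility of $l$ from $k$ meaning $B^n(k,l)=1$ for some $n\ge0$; period of a closed class $=\gcd\{n\ge1:B^n(k,k)=1\}$ for any $k$ in it). A communicating class $\mathcal{C}$ is closed if $B^n(k,l)=0$ for all $k\in\mathcal{C}$, $l\notin\mathcal{C}$, $n\ge1$. A recurrent class of a stochastic matrix is a closed communicating class. *)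

theory Defs
  imports "HOL-Probability.Probability"
begin

definition words :: "'a set \<Rightarrow> nat \<Rightarrow> 'a list set" where
  "words A n = {x. set x \<subseteq> A \<and> length x = n}"

(* The subword x_i, ..., x_j with positions counted from 1; empty if i > j. *)
definition seg :: "'a list \<Rightarrow> nat \<Rightarrow> nat \<Rightarrow> 'a list" where
  "seg x i j = take (Suc j - i) (drop (i - 1) x)"

definition transition_kernel :: "'a set \<Rightarrow> nat \<Rightarrow> ('a list \<Rightarrow> 'a \<Rightarrow> real) \<Rightarrow> bool" where
  "transition_kernel A m p \<longleftrightarrow>
     (\<forall>x\<in>words A m. (\<forall>a\<in>A. 0 \<le> p x a \<and> p x a \<le> 1) \<and> (\<Sum>a\<in>A. p x a) = 1)"

(* Time starts at 0. The word h is the whole past X_0, ..., X_(n-1), oldest symbol first, and only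
   its last m symbols influence the law of X_n. Pasts of probability 0 impose no condition. *)
definition markov_chain_of_order ::
  "'w measure \<Rightarrow> 'a set \<Rightarrow> nat \<Rightarrow> ('a list \<Rightarrow> 'a \<Rightarrow> real) \<Rightarrow> (nat \<Rightarrow> 'w \<Rightarrow> 'a) \<Rightarrow> bool" where
  "markov_chain_of_order W A m p X \<longleftrightarrow>
     prob_space W \<and> transition_kernel A m p \<and>
     (\<forall>n. X n \<in> measurable W (count_space A)) \<and>
     (\<forall>n\<ge>m. \<forall>h\<in>words A n. \<forall>a\<in>A.
        \<P>(\<omega> in W. map (\<lambda>i. X i \<omega>) [0..<n] = h) > 0 \<longrightarrow>
        \<P>(\<omega> in W. X n \<omega> = a \<bar> map (\<lambda>i. X i \<omega>) [0..<n] = h) = p (seg h (n - m + 1) n) a)"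

definition transition_matrix ::
  "'a set \<Rightarrow> nat \<Rightarrow> ('a list \<Rightarrow> 'a \<Rightarrow> real) \<Rightarrow> 'a list \<Rightarrow> 'a list \<Rightarrow> real" where
  "transition_matrix A m p x y =
     (if x \<in> words A m \<and> (\<exists>a\<in>A. y = seg x 2 m @ [a]) then p x (last y) else 0)"

(* The condition always holds for i = m - 1, where y is the empty word; hence the minimum is
   attained below m and the truncated subtractions are harmless. *)
definition skeleton_tau :: "'a set \<Rightarrow> nat \<Rightarrow> ('a list \<Rightarrow> 'a \<Rightarrow> real) \<Rightarrow> 'a list \<Rightarrow> 'a \<Rightarrow> nat" where
  "skeleton_tau A m p x a =
     (LEAST i. (\<forall>y\<in>words A (m - i - 1). p (y @ seg x (m - i) m) a = 0) \<or>
               (\<forall>y\<in>words A (m - i - 1). p (y @ seg x (m - i) m) a > 0))"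

definition skeleton_order :: "'a set \<Rightarrow> nat \<Rightarrow> ('a list \<Rightarrow> 'a \<Rightarrow> real) \<Rightarrow> nat" where
  "skeleton_order A m p = 1 + (SUP x\<in>words A m. SUP a\<in>A. skeleton_tau A m p x a)"

definition skeleton_matrix ::
  "'a set \<Rightarrow> nat \<Rightarrow> ('a list \<Rightarrow> 'a \<Rightarrow> real) \<Rightarrow> 'a list \<Rightarrow> 'a list \<Rightarrow> nat" where
  "skeleton_matrix A m p u v =
     (let K = skeleton_order A m p in
      of_bool (\<exists>x\<in>words A K. \<exists>a\<in>A. u = seg x 1 K \<and> v = seg x 2 K @ [a] \<and>
                 (\<forall>y\<in>words A (m - K). p (y @ seg x 1 K) a > 0)))"

definition admissible_words :: "'a set \<Rightarrow> nat \<Rightarrow> ('a list \<Rightarrow> 'a \<Rightarrow> real) \<Rightarrow> 'a list set" where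
  "admissible_words A m p =
     (let K = skeleton_order A m p in
      if K = m then words A m
      else {x \<in> words A m.
              (\<Prod>j = 1..m - K.
                 skeleton_matrix A m p (seg x j (j + K - 1)) (seg x (j + 1) (j + K))) = 1})"

primrec mat_pow :: "'s set \<Rightarrow> ('s \<Rightarrow> 's \<Rightarrow> real) \<Rightarrow> nat \<Rightarrow> 's \<Rightarrow> 's \<Rightarrow> real" where
  "mat_pow E B 0 k l = of_bool (k = l)"
| "mat_pow E B (Suc n) k l = (\<Sum>j\<in>E. B k j * mat_pow E B n j l)"

(* Truncating the sum at 1 gives Boolean addition on {0, 1}. *)
primrec bool_mat_pow :: "'s set \<Rightarrow> ('s \<Rightarrow> 's \<Rightarrow> nat) \<Rightarrow> nat \<Rightarrow> 's \<Rightarrow> 's \<Rightarrow> nat" where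
  "bool_mat_pow E B 0 k l = of_bool (k = l)"
| "bool_mat_pow E B (Suc n) k l = min 1 (\<Sum>j\<in>E. B k j * bool_mat_pow E B n j l)"

(* Classes and periods depend on a matrix only through which entries of its powers are nonzero.
   Below, r n k l says that the (k, l) entry of the n-th power is nonzero. *)
definition accessible :: "(nat \<Rightarrow> 's \<Rightarrow> 's \<Rightarrow> bool) \<Rightarrow> 's \<Rightarrow> 's \<Rightarrow> bool" where
  "accessible r k l \<longleftrightarrow> (\<exists>n. r n k l)"

definition communicating_classes :: "'s set \<Rightarrow> (nat \<Rightarrow> 's \<Rightarrow> 's \<Rightarrow> bool) \<Rightarrow> 's set set" where
  "communicating_classes E r =
     {C. \<exists>k\<in>E. C = {l \<in> E. accessible r k l \<and> accessible r l k}}"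

definition closed_classes :: "'s set \<Rightarrow> (nat \<Rightarrow> 's \<Rightarrow> 's \<Rightarrow> bool) \<Rightarrow> 's set set" where
  "closed_classes E r =
     {C \<in> communicating_classes E r. \<forall>k\<in>C. \<forall>l\<in>E - C. \<forall>n\<ge>1. \<not> r n k l}"

definition class_period :: "(nat \<Rightarrow> 's \<Rightarrow> 's \<Rightarrow> bool) \<Rightarrow> 's set \<Rightarrow> nat" where
  "class_period r C = (THE d. \<forall>k\<in>C. Gcd {n. n \<ge> 1 \<and> r n k k} = d)"

definition stochastic_steps :: "'s set \<Rightarrow> ('s \<Rightarrow> 's \<Rightarrow> real) \<Rightarrow> nat \<Rightarrow> 's \<Rightarrow> 's \<Rightarrow> bool" where
  "stochastic_steps E B n k l \<longleftrightarrow> mat_pow E B n k l > 0"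

definition binary_steps :: "'s set \<Rightarrow> ('s \<Rightarrow> 's \<Rightarrow> nat) \<Rightarrow> nat \<Rightarrow> 's \<Rightarrow> 's \<Rightarrow> bool" where
  "binary_steps E B n k l \<longleftrightarrow> bool_mat_pow E B n k l = 1"

definition recurrent_classes :: "'s set \<Rightarrow> ('s \<Rightarrow> 's \<Rightarrow> real) \<Rightarrow> 's set set" where
  "recurrent_classes E B = closed_classes E (stochastic_steps E B)"

end

theory Submission imports Defs begin

text \<open>
  Whether \<open>p x a > 0\<close> holds depends only on the last \<open>K\<close> letters of \<open>x\<close>. Hence, for both the
  transition matrix and the skeleton matrix, a \<open>t\<close>-step path is a word \<open>w\<close> of length \<open>t\<close> appended to
  the starting word such that every letter of \<open>w\<close> is allowed after the \<open>K\<close> letters preceding it.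
  Dropping the first \<open>m - K\<close> letters projects transition paths to skeleton paths, and every skeleton
  path lifts. An admissible \<open>y\<close> is reached by first reaching its initial \<open>K\<close> letters in the skeleton
  and then spelling out the rest of \<open>y\<close>. So the closed classes correspond to each other, and comparing
  closed paths with and without an inserted skeleton cycle gives equality of periods.
\<close>

section \<open>Classes and periods of a relation\<close>

lemma binary_steps_eq_relpow:
  assumes "finite E"
  shows "binary_steps E B = (\<lambda>n k l. (k, l) \<in> {(k, l). l \<in> E \<and> B k l \<noteq> 0} ^^ n)"
proof -
  let ?S = "{(k, l). l \<in> E \<and> B k l \<noteq> 0}"
  have "bool_mat_pow E B n k l = of_bool ((k, l) \<in> ?S ^^ n)" for n k l
  proof (induction n arbitrary: k)
    case 0
    show ?case by simp
  next
    case (Suc n)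
    \<comment> \<open>\<open>relpow\<close> splits off the last step of a path, whereas the matrix
      powers split off the first.\<close>
    have eq: "(k, l) \<in> ?S ^^ Suc n \<longleftrightarrow> (\<exists>j. (k, j) \<in> ?S \<and> (j, l) \<in> ?S ^^ n)"
      by (meson relpow_Suc_D2 relpow_Suc_I2)
    have z: "(\<Sum>j\<in>E. B k j * bool_mat_pow E B n j l) = 0 \<longleftrightarrow> \<not> (k, l) \<in> ?S ^^ Suc n"
      unfolding eq using assms by (auto simp: Suc.IH)
    show ?case
      using z by (cases "(k, l) \<in> ?S ^^ Suc n") (simp_all del: relpow.simps)
  qed
  then show ?thesis
    by (auto simp: binary_steps_def fun_eq_iff)
qed

text \<open>Nonnegative terms cannot cancel, so a sum of products is positive exactly when both
  factors of some summand are.\<close>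

lemma stochastic_steps_eq_relpow:
  assumes "finite E" and B: "\<And>k l. 0 \<le> B k l"
  shows "stochastic_steps E B = (\<lambda>n k l. (k, l) \<in> {(k, l). l \<in> E \<and> B k l > 0} ^^ n)"
proof -
  let ?S = "{(k, l). l \<in> E \<and> B k l > 0}"
  have nonneg: "0 \<le> mat_pow E B n k l" for n k l
    by (induction n arbitrary: k) (auto intro!: sum_nonneg mult_nonneg_nonneg B)
  have "mat_pow E B n k l > 0 \<longleftrightarrow> (k, l) \<in> ?S ^^ n" for n k l
  proof (induction n arbitrary: k)
    case 0
    show ?case by simp
  next
    case (Suc n)
    have eq: "(k, l) \<in> ?S ^^ Suc n \<longleftrightarrow> (\<exists>j. (k, j) \<in> ?S \<and> (j, l) \<in> ?S ^^ n)"
      by (meson relpow_Suc_D2 relpow_Suc_I2)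
    have nn: "0 \<le> B k j * mat_pow E B n j l" for j
      by (intro mult_nonneg_nonneg B nonneg)
    have "mat_pow E B (Suc n) k l > 0 \<longleftrightarrow> mat_pow E B (Suc n) k l \<noteq> 0"
      using nonneg[of "Suc n" k l] by linarith
    also have "\<dots> \<longleftrightarrow> (\<exists>j\<in>E. B k j * mat_pow E B n j l \<noteq> 0)"
      using sum_nonneg_eq_0_iff[OF assms(1), of "\<lambda>j. B k j * mat_pow E B n j l"] nn by auto
    also have "\<dots> \<longleftrightarrow> (\<exists>j\<in>E. B k j > 0 \<and> mat_pow E B n j l > 0)"
      using B nonneg by (metis less_eq_real_def mult_eq_0_iff order_less_irrefl)
    finally show ?case
      unfolding eq using Suc.IH by auto
  qed
  then show ?thesis
    by (auto simp: stochastic_steps_def fun_eq_iff)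
qed

section \<open>Closed classes\<close>

lemma accessible_relpow: "accessible (\<lambda>n k l. (k, l) \<in> S ^^ n) k l \<longleftrightarrow> (k, l) \<in> S\<^sup>*"
  by (simp add: accessible_def rtrancl_is_UN_relpow)

text \<open>Frees closed classes from representatives and exponents, leaving conditions on
  reachability that can be carried from one chain to another.\<close>

lemma closed_classes_iff:
  assumes "S \<subseteq> E \<times> E"
  shows "C \<in> closed_classes E (\<lambda>n k l. (k, l) \<in> S ^^ n) \<longleftrightarrow>
    C \<noteq> {} \<and> C \<subseteq> E \<and> C \<times> C \<subseteq> S\<^sup>* \<and> S\<^sup>* `` C \<subseteq> C" (is "?L \<longleftrightarrow> ?R")
proof
  assume ?L
  then obtain k where k: "k \<in> E" and C: "C = {l \<in> E. (k, l) \<in> S\<^sup>* \<and> (l, k) \<in> S\<^sup>*}"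
    and cl: "\<And>k l n. \<lbrakk>k \<in> C; l \<in> E; l \<notin> C; n \<ge> 1\<rbrakk> \<Longrightarrow> (k, l) \<notin> S ^^ n"
    unfolding closed_classes_def communicating_classes_def accessible_relpow by auto
  have "C \<times> C \<subseteq> S\<^sup>*"
    unfolding C by (auto intro: rtrancl_trans)
  moreover have "l \<in> C" if "j \<in> C" and jl: "(j, l) \<in> S\<^sup>*" for j l
    using jl \<open>j \<in> C\<close>
  proof (induction rule: rtrancl_induct)
    case (step y z)
    \<comment> \<open>Closedness is applied to a single step;
      \<open>S \<subseteq> E \<times> E\<close> puts \<open>z\<close> into \<open>E\<close>.\<close>
    then show ?case using cl[of y z 1] assms by auto
  qed
  moreover have "k \<in> C" "C \<subseteq> E"
    using k by (auto simp: C)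
  ultimately show ?R by blast
next
  assume R: ?R
  then obtain k where k: "k \<in> C" by auto
  have "\<exists>k\<in>E. C = {l \<in> E. (k, l) \<in> S\<^sup>* \<and> (l, k) \<in> S\<^sup>*}"
    using R k by blast
  moreover have "\<forall>j\<in>C. \<forall>l\<in>E - C. \<forall>n\<ge>1. (j, l) \<notin> S ^^ n"
    using R relpow_imp_rtrancl[where R = S] by blast
  ultimately show ?L
    using k R unfolding closed_classes_def communicating_classes_def accessible_relpow
    by (intro CollectI conjI) auto
qed

text \<open>From any of its elements a closed class reaches itself and nothing else, so one common
  element determines it.\<close>

lemma closed_classes_eqI:
  assumes "S \<subseteq> E \<times> E"
    and "C \<in> closed_classes E (\<lambda>n k l. (k, l) \<in> S ^^ n)"
    and "D \<in> closed_classes E (\<lambda>n k l. (k, l) \<in> S ^^ n)"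
    and "k \<in> C" "k \<in> D"
  shows "C = D"
  using assms(2-) unfolding closed_classes_iff[OF assms(1)] by blast

section \<open>Periods\<close>

definition period :: "'s rel \<Rightarrow> 's \<Rightarrow> nat" where
  "period S k = Gcd {n. n \<ge> 1 \<and> (k, k) \<in> S ^^ n}"

lemma period_dvd: "(k, k) \<in> S ^^ n \<Longrightarrow> period S k dvd n"
  unfolding period_def by (cases "n = 0") (auto intro: Gcd_dvd)

text \<open>Inserting a cycle at \<open>l\<close> into a closed path from \<open>k\<close> through
  \<open>l\<close> changes its length by the length of the cycle. The period of \<open>k\<close>
  divides both lengths, hence their difference.\<close>

lemma period_dvd_period:
  assumes "(k, l) \<in> S\<^sup>*" "(l, k) \<in> S\<^sup>*"
  shows "period S k dvd period S l"
proof -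
  obtain a b where a: "(k, l) \<in> S ^^ a" and b: "(l, k) \<in> S ^^ b"
    using assms by (auto simp: rtrancl_is_UN_relpow)
  have "period S k dvd n" if "(l, l) \<in> S ^^ n" for n
  proof -
    have "period S k dvd (a + b)" "period S k dvd (a + n + b)"
      using a b that by (blast intro: period_dvd relpow_trans)+
    then have "period S k dvd (a + n + b) - (a + b)"
      by (rule dvd_diff_nat[rotated])
    then show ?thesis by simp
  qed
  then show ?thesis
    unfolding period_def[of S l] by (intro Gcd_greatest) auto
qed

text \<open>Periods agree throughout the class, so the definite description in
  \<open>class_period\<close> is well defined and can be evaluated at any member.\<close>

lemma class_period_eq:
  assumes "S \<subseteq> E \<times> E" "C \<in> closed_classes E (\<lambda>n k l. (k, l) \<in> S ^^ n)" "k \<in> C"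
  shows "class_period (\<lambda>n k l. (k, l) \<in> S ^^ n) C = period S k"
proof -
  have "C \<times> C \<subseteq> S\<^sup>*"
    using assms(2) unfolding closed_classes_iff[OF assms(1)] by blast
  then have "(k, l) \<in> S\<^sup>*" "(l, k) \<in> S\<^sup>*" if "l \<in> C" for l
    using assms(3) that by auto
  then have "\<forall>l\<in>C. period S l = period S k"
    by (intro ballI dvd_antisym period_dvd_period)
  then have "(THE d. \<forall>l\<in>C. period S l = d) = period S k"
    using assms(3) by (intro the_equality) metis+
  then show ?thesis
    by (simp add: class_period_def period_def)
qed

section \<open>Chains driven by the last letters of a word\<close>

text \<open>\<open>q u a\<close> stands for: the letter \<open>a\<close> can follow the window
  \<open>u\<close> of the last \<open>K\<close> letters. \<open>total\<close> reflects that every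
  row of a stochastic matrix has a positive entry.\<close>

locale window_chain =
  fixes A :: "'a set" and K :: nat and q :: "'a list \<Rightarrow> 'a \<Rightarrow> bool"
  assumes K_pos: "1 \<le> K"
    and total: "u \<in> words A K \<Longrightarrow> \<exists>a\<in>A. q u a"
begin

text \<open>The length is a parameter so that \<open>n = m\<close> yields the transition matrix and
  \<open>n = K\<close> the skeleton matrix.\<close>

definition step :: "nat \<Rightarrow> 'a list rel" where
  "step n = {(x, tl x @ [a]) | x a. x \<in> words A n \<and> a \<in> A \<and> q (drop (n - K) x) a}"

text \<open>Asked of words of every length, so that an entire path, written as one long word, can be
  tested.\<close>

definition admissible :: "'a list \<Rightarrow> bool" where
  "admissible w \<longleftrightarrow> (\<forall>j. j + K < length w \<longrightarrow> q (take K (drop j w)) (w ! (j + K)))"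

text \<open>The candidate for the recurrent class that belongs to \<open>C\<close>.\<close>

definition lift_class :: "nat \<Rightarrow> 'a list set \<Rightarrow> 'a list set" where
  "lift_class m C = {x \<in> words A m. admissible x \<and> take K x \<in> C}"

section \<open>Extending, cutting and gluing admissible words\<close>

lemma admissible_short: "length w \<le> K \<Longrightarrow> admissible w"
  by (auto simp: admissible_def)

lemma admissible_snoc:
  "admissible (u @ [a]) \<longleftrightarrow> admissible u \<and> (K \<le> length u \<longrightarrow> q (drop (length u - K) u) a)"
proof -
  have old: "q (take K (drop j (u @ [a]))) ((u @ [a]) ! (j + K)) \<longleftrightarrow> q (take K (drop j u)) (u ! (j + K))"
    if "j + K < length u" for j
    using that by (simp add: nth_append)
  have new: "q (take K (drop j (u @ [a]))) ((u @ [a]) ! (j + K)) \<longleftrightarrow> q (drop (length u - K) u) a"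
    if "j + K = length u" for j
  proof -
    have "j = length u - K" "K \<le> length u" using that by auto
    then show ?thesis by (simp add: nth_append)
  qed
  show ?thesis
  proof
    assume L: "admissible (u @ [a])"
    have "admissible u"
      unfolding admissible_def using L old by (auto simp: admissible_def)
    moreover have "q (drop (length u - K) u) a" if "K \<le> length u"
      using L[unfolded admissible_def, rule_format, of "length u - K"] new[of "length u - K"] that by simp
    ultimately show "admissible u \<and> (K \<le> length u \<longrightarrow> q (drop (length u - K) u) a)" by simp
  next
    assume R: "admissible u \<and> (K \<le> length u \<longrightarrow> q (drop (length u - K) u) a)"
    show "admissible (u @ [a])"
      unfolding admissible_def
    proof (intro allI impI)
      fix j assume "j + K < length (u @ [a])"
      then consider "j + K < length u" | "j + K = length u" by fastforce
      then show "q (take K (drop j (u @ [a]))) ((u @ [a]) ! (j + K))"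
        using R old[of j] new[of j] by cases (auto simp: admissible_def)
    qed
  qed
qed

lemma admissible_prefix: "admissible (u @ v) \<Longrightarrow> admissible u"
proof (induction v rule: rev_induct)
  case (snoc a v)
  then show ?case using admissible_snoc[of "u @ v" a] by simp
qed simp

lemma admissible_suffix:
  assumes "admissible (u @ v)"
  shows "admissible v"
  unfolding admissible_def
proof (intro allI impI)
  fix j assume "j + K < length v"
  then show "q (take K (drop j v)) (v ! (j + K))"
    using assms[unfolded admissible_def, rule_format, of "length u + j"]
    by (simp add: nth_append add.assoc)
qed

text \<open>A test involves \<open>K + 1\<close> consecutive letters. As the overlap
  \<open>v\<close> has at least \<open>K\<close> letters, these lie within \<open>u @ v\<close> or
  within \<open>v @ w\<close>.\<close>

lemma admissible_glue:
  assumes "admissible (u @ v)" "admissible (v @ w)" "K \<le> length v"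
  shows "admissible (u @ v @ w)"
  using assms(2)
proof (induction w rule: rev_induct)
  case Nil
  then show ?case using assms(1) by simp
next
  case (snoc a w)
  have "admissible (v @ w)" and q: "q (drop (length (v @ w) - K) (v @ w)) a"
    using snoc.prems admissible_snoc[of "v @ w" a] assms(3) by auto
  then have "admissible (u @ v @ w)" using snoc.IH by simp
  moreover have "drop (length (u @ v @ w) - K) (u @ v @ w) = drop (length (v @ w) - K) (v @ w)"
    using assms(3) by (simp add: drop_append)
  ultimately show ?case
    using q admissible_snoc[of "u @ v @ w" a] by simp
qed

section \<open>Paths as appended words\<close>

lemma step_subset:
  assumes "1 \<le> n"
  shows "step n \<subseteq> words A n \<times> words A n"
proof -
  have "set (tl x) \<subseteq> set x" for x :: "'a list" by (cases x) auto
  with assms show ?thesis by (fastforce simp: step_def words_def)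
qed

lemma drop_append_words:
  assumes "x \<in> words A m"
  shows "drop (m - K) (drop t (x @ w)) = drop t (drop (m - K) x @ w)"
proof -
  have "drop (m - K) x @ w = drop (m - K) (x @ w)" using assms by (simp add: words_def)
  then show ?thesis by (simp add: add.commute del: drop_append)
qed

text \<open>The states of a path are the windows of length \<open>n\<close> sliding over
  \<open>x @ w\<close>. The first tested window consists of the last \<open>K\<close> letters of
  \<open>x\<close>, so admissibility is asked only from there on.\<close>

lemma relpow_step_iff:
  assumes "K \<le> n" "x \<in> words A n"
  shows "(x, y) \<in> step n ^^ t \<longleftrightarrow>
    (\<exists>w\<in>words A t. y = drop t (x @ w) \<and> admissible (drop (n - K) x @ w))"
proof (induction t arbitrary: y)
  case 0
  have "admissible (drop (n - K) x)"
    using assms by (intro admissible_short) (simp add: words_def)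
  then show ?case by (auto simp: words_def)
next
  case (Suc t)
  \<comment> \<open>The last \<open>K\<close> letters of the current state are also the last
    \<open>K\<close> letters of the word tested by \<open>admissible_snoc\<close>.\<close>
  have window: "drop (n - K) (drop t (x @ w)) =
      drop (length (drop (n - K) x @ w) - K) (drop (n - K) x @ w)"
    if "w \<in> words A t" for w
    using that assms unfolding drop_append_words[OF assms(2)]
    by (simp add: words_def del: drop_append)
  have shift: "tl (drop t (x @ w)) @ [a] = drop (Suc t) (x @ w @ [a])" if "w \<in> words A t" for w a
  proof -
    have "tl (drop t (x @ w)) = drop (Suc t) (x @ w)"
      by (simp add: drop_Suc tl_drop del: drop_append)
    \<comment> \<open>Since \<open>n \<ge> K \<ge> 1\<close>, \<open>x @ w\<close> has at least
      \<open>Suc t\<close> letters and the appended letter survives the shift.\<close>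
    moreover have "drop (Suc t) ((x @ w) @ [a]) = drop (Suc t) (x @ w) @ [a]"
      using that assms K_pos by (simp add: words_def)
    ultimately show ?thesis by simp
  qed
  have word: "drop t (x @ w) \<in> words A n" if "w \<in> words A t" for w
    using that assms by (auto simp: words_def dest: in_set_dropD)
  show ?case
  proof
    assume "(x, y) \<in> step n ^^ Suc t"
    then obtain z where "(x, z) \<in> step n ^^ t" "(z, y) \<in> step n" by auto
    then obtain w a where w: "w \<in> words A t" "z = drop t (x @ w)" "admissible (drop (n - K) x @ w)"
      and a: "a \<in> A" "y = tl z @ [a]" "q (drop (n - K) z) a"
      unfolding Suc.IH by (auto simp: step_def)
    have "admissible ((drop (n - K) x @ w) @ [a])"
      unfolding admissible_snoc using w a(3) window[OF w(1)] by metis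
    then show "\<exists>w\<in>words A (Suc t). y = drop (Suc t) (x @ w) \<and> admissible (drop (n - K) x @ w)"
      using w a shift[of w a] by (intro bexI[of _ "w @ [a]"]) (auto simp: words_def)
  next
    assume "\<exists>w\<in>words A (Suc t). y = drop (Suc t) (x @ w) \<and> admissible (drop (n - K) x @ w)"
    then obtain w' where w': "w' \<in> words A (Suc t)" "y = drop (Suc t) (x @ w')"
      "admissible (drop (n - K) x @ w')" by blast
    then obtain w a where wa: "w' = w @ [a]"
      by (cases w' rule: rev_cases) (auto simp: words_def)
    have w: "w \<in> words A t" and a: "a \<in> A" using w' wa by (auto simp: words_def)
    have "K \<le> length (drop (n - K) x @ w)" using assms by (simp add: words_def)
    then have "admissible (drop (n - K) x @ w)" "q (drop (n - K) (drop t (x @ w))) a"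
      using w'(3) admissible_snoc[of "drop (n - K) x @ w" a] window[OF w] wa by simp_all
    then have "(x, drop t (x @ w)) \<in> step n ^^ t"
      and "(drop t (x @ w), tl (drop t (x @ w)) @ [a]) \<in> step n"
      using w a word[OF w] unfolding Suc.IH by (auto simp: step_def simp del: drop_append)
    moreover have "y = tl (drop t (x @ w)) @ [a]"
      using shift[OF w, of a] w'(2) wa by metis
    ultimately show "(x, y) \<in> step n ^^ Suc t" by auto
  qed
qed

lemma relpow_step_words:
  assumes "1 \<le> n" "x \<in> words A n" "(x, y) \<in> step n ^^ t"
  shows "y \<in> words A n"
  using assms step_subset[OF assms(1)] by (cases t) auto

lemma relpow_step_total:
  assumes "K \<le> n" "x \<in> words A n"
  shows "\<exists>y. (x, y) \<in> step n ^^ t"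
proof (induction t)
  case 0
  show ?case by auto
next
  case (Suc t)
  then obtain y where y: "(x, y) \<in> step n ^^ t" by blast
  then have "y \<in> words A n" using relpow_step_words[OF _ assms(2)] assms(1) K_pos by fastforce
  moreover from this have "drop (n - K) y \<in> words A K"
    using assms by (auto simp: words_def dest: in_set_dropD)
  ultimately obtain a where "(y, tl y @ [a]) \<in> step n"
    using total by (auto simp: step_def)
  with y show ?case by auto
qed

section \<open>Passing between words of length m and length K\<close>

lemma drop_in_words: "K \<le> m \<Longrightarrow> x \<in> words A m \<Longrightarrow> drop (m - K) x \<in> words A K"
  by (auto simp: words_def dest: in_set_dropD)

lemma take_in_words: "K \<le> m \<Longrightarrow> x \<in> words A m \<Longrightarrow> take K x \<in> words A K"
  by (auto simp: words_def dest: in_set_takeD)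

text \<open>The same appended word serves both chains: admissibility concerns
  \<open>drop (m - K) x @ w\<close> in either case. The converse \<open>step_lift\<close> appends
  that word to \<open>x\<close>.\<close>

lemma step_project:
  assumes "K \<le> m" "x \<in> words A m" "(x, y) \<in> step m ^^ t"
  shows "(drop (m - K) x, drop (m - K) y) \<in> step K ^^ t"
  using assms(3) unfolding relpow_step_iff[OF assms(1,2)]
    relpow_step_iff[OF order_refl drop_in_words[OF assms(1,2)]]
  by (auto simp: drop_append_words[OF assms(2)] simp del: drop_append drop_drop)

lemma step_lift:
  assumes "K \<le> m" "x \<in> words A m" "(drop (m - K) x, v) \<in> step K ^^ t"
  shows "\<exists>y. (x, y) \<in> step m ^^ t \<and> drop (m - K) y = v"
  using assms(3) unfolding relpow_step_iff[OF assms(1,2)]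
    relpow_step_iff[OF order_refl drop_in_words[OF assms(1,2)]]
  by (auto simp: drop_append_words[OF assms(2), symmetric] simp del: drop_append drop_drop)

text \<open>Reading an admissible word from its first \<open>K\<close> letters onwards is itself a
  skeleton path, ending in its last window.\<close>

lemma step_spell:
  assumes "K \<le> m" "x \<in> words A m" "admissible x"
  shows "(take K x, drop (m - K) x) \<in> step K ^^ (m - K)"
  unfolding relpow_step_iff[OF order_refl take_in_words[OF assms(1,2)]]
  using assms by (intro bexI[of _ "drop K x"]) (auto simp: words_def dest: in_set_dropD)

text \<open>Follow the skeleton path until the newest \<open>K\<close> letters are
  \<open>take K y\<close>, then append \<open>drop K y\<close>. These \<open>m - K\<close> further
  steps push out every letter preceding \<open>take K y\<close>.\<close>

lemma step_reach:
  assumes "K \<le> m" "x \<in> words A m" "y \<in> words A m" "admissible y"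
    and "(drop (m - K) x, take K y) \<in> step K ^^ t"
  shows "(x, y) \<in> step m ^^ (t + (m - K))"
proof -
  obtain w where w: "w \<in> words A t" and y: "take K y = drop t (drop (m - K) x @ w)"
    and adm: "admissible (drop (m - K) x @ w)"
    using assms(5) unfolding relpow_step_iff[OF order_refl drop_in_words[OF assms(1,2)]] by auto
  \<comment> \<open>\<open>u\<close> is the part in front of the copy of \<open>take K y\<close>;
    that copy, of length \<open>K\<close>, is the overlap for gluing.\<close>
  define u where "u = take t (drop (m - K) x @ w)"
  have uy: "drop (m - K) x @ w = u @ take K y"
    unfolding u_def y by (rule append_take_drop_id[symmetric])
  have "admissible (u @ take K y @ drop K y)"
    using adm assms unfolding uy by (intro admissible_glue) (auto simp: words_def)
  then have "admissible (drop (m - K) x @ w @ drop K y)"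
    using uy by (metis append.assoc)
  moreover have "drop (t + (m - K)) (x @ w @ drop K y) = y"
  proof -
    have "drop (t + (m - K)) (x @ w @ drop K y) = drop (t + (m - K)) (x @ w) @ drop K y"
      using w assms(1,2) by (simp add: words_def drop_append)
    also have "drop (t + (m - K)) (x @ w) = take K y"
      unfolding y drop_append_words[OF assms(2), symmetric]
      by (simp add: add.commute del: drop_append)
    finally show ?thesis by simp
  qed
  moreover have "w @ drop K y \<in> words A (t + (m - K))"
    using w assms by (auto simp: words_def dest: in_set_dropD)
  ultimately show ?thesis
    unfolding relpow_step_iff[OF assms(1,2)] by (metis append.assoc)
qed

text \<open>Complements \<open>step_project\<close> by tracking the oldest \<open>K\<close> letters
  of the state. They also slide over \<open>x @ w\<close>, starting \<open>m - K\<close> positions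
  earlier, and for admissible \<open>x\<close> that whole word is admissible.\<close>

lemma step_admissible:
  assumes "K \<le> m" "x \<in> words A m" "admissible x" "(x, y) \<in> step m ^^ t"
  shows "admissible y \<and> (take K x, take K y) \<in> step K ^^ t"
proof -
  obtain w where w: "w \<in> words A t" and y: "y = drop t (x @ w)"
    and adm: "admissible (drop (m - K) x @ w)"
    using assms(4) unfolding relpow_step_iff[OF assms(1,2)] by auto
  have "admissible (take (m - K) x @ drop (m - K) x @ w)"
    using adm assms by (intro admissible_glue) (auto simp: words_def)
  then have xw: "admissible (x @ w)" by (simp add: append_assoc[symmetric] del: append_assoc)
  then have "admissible y"
    unfolding y by (metis admissible_suffix append_take_drop_id)
  \<comment> \<open>The witness for the skeleton path consists of the \<open>t\<close> letters of
    \<open>x @ w\<close> after the first \<open>K\<close>.\<close>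
  moreover have eq: "take K x @ take t (drop K (x @ w)) = take (K + t) (x @ w)"
    unfolding take_add using assms by (simp add: words_def)
  have "admissible (take (K + t) (x @ w))"
    using xw by (metis admissible_prefix append_take_drop_id)
  moreover have "take K y = drop t (take (K + t) (x @ w))"
    unfolding y by (simp add: take_drop add.commute del: take_append drop_append)
  moreover have "take t (drop K (x @ w)) \<in> words A t"
    using w assms by (auto simp: words_def dest!: in_set_takeD in_set_dropD)
  ultimately show ?thesis
    unfolding relpow_step_iff[OF order_refl take_in_words[OF assms(1,2)]]
    by (intro conjI bexI[of _ "take t (drop K (x @ w))"]) (simp_all only: eq diff_self_eq_0 drop_0)
qed

text \<open>After \<open>m - K\<close> steps the state is \<open>drop (m - K) x @ w\<close>, exactly
  the word whose admissibility the path guarantees.\<close>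

lemma step_fill:
  assumes "K \<le> m" "x \<in> words A m" "(x, y) \<in> step m ^^ (m - K)"
  shows "admissible y \<and> take K y = drop (m - K) x"
  using assms unfolding relpow_step_iff[OF assms(1,2)]
  by (auto simp: words_def)

section \<open>Correspondence of closed classes and their periods\<close>

abbreviation step_classes :: "nat \<Rightarrow> 'a list set set" where
  "step_classes n \<equiv> closed_classes (words A n) (\<lambda>t x y. (x, y) \<in> step n ^^ t)"

lemma step_classes_iff:
  assumes "K \<le> n"
  shows "C \<in> step_classes n \<longleftrightarrow>
    C \<noteq> {} \<and> C \<subseteq> words A n \<and> C \<times> C \<subseteq> (step n)\<^sup>* \<and> (step n)\<^sup>* `` C \<subseteq> C"
  using K_pos assms by (intro closed_classes_iff step_subset) simp

lemma lift_class_closed: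
  assumes "K \<le> m" "C \<in> step_classes K"
  shows "lift_class m C \<in> step_classes m"
proof -
  have C: "C \<noteq> {}" "C \<subseteq> words A K" "C \<times> C \<subseteq> (step K)\<^sup>*" "(step K)\<^sup>* `` C \<subseteq> C"
    using assms(2) step_classes_iff[of K] by auto
  obtain u where u: "u \<in> C" using C by auto
  \<comment> \<open>Nonemptiness: by totality \<open>u\<close> can be continued for
    \<open>m - K\<close> letters.\<close>
  obtain w where w: "w \<in> words A (m - K)" "admissible (u @ w)"
    using relpow_step_total[of K u "m - K"] u C(2) relpow_step_iff[of K u _ "m - K"] by auto
  then have "u @ w \<in> lift_class m C"
    using u C(2) assms(1) by (auto simp: lift_class_def words_def)
  moreover have "(x, y) \<in> (step m)\<^sup>*" if "x \<in> lift_class m C" "y \<in> lift_class m C" for x y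
  proof -
    \<comment> \<open>Spelling out \<open>x\<close> shows that its last window, from which paths
      continue, lies in the closed class \<open>C\<close> as well.\<close>
    have "(take K x, drop (m - K) x) \<in> (step K)\<^sup>*"
      using that assms(1) by (auto simp: lift_class_def intro!: relpow_imp_rtrancl step_spell)
    then have "drop (m - K) x \<in> C" using C(4) that by (auto simp: lift_class_def)
    then have "(drop (m - K) x, take K y) \<in> (step K)\<^sup>*"
      using C(3) that by (auto simp: lift_class_def)
    then obtain t where "(drop (m - K) x, take K y) \<in> step K ^^ t"
      by (auto simp: rtrancl_is_UN_relpow)
    then have "(x, y) \<in> step m ^^ (t + (m - K))"
      using that assms(1) by (intro step_reach) (auto simp: lift_class_def)
    then show ?thesis by (rule relpow_imp_rtrancl)
  qed
  moreover have "y \<in> lift_class m C" if x: "x \<in> lift_class m C" and xy: "(x, y) \<in> (step m)\<^sup>*" for x y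
  proof -
    obtain t where t: "(x, y) \<in> step m ^^ t"
      using xy by (auto simp: rtrancl_is_UN_relpow)
    have "admissible y" "(take K x, take K y) \<in> step K ^^ t"
      using step_admissible[OF assms(1) _ _ t] x by (auto simp: lift_class_def)
    moreover from this have "take K y \<in> C"
      using C(4) x by (auto simp: lift_class_def dest: relpow_imp_rtrancl)
    moreover have "y \<in> words A m"
      using relpow_step_words[OF _ _ t] x K_pos assms(1) by (auto simp: lift_class_def)
    ultimately show ?thesis by (simp add: lift_class_def)
  qed
  moreover have "lift_class m C \<subseteq> words A m" by (auto simp: lift_class_def)
  ultimately show ?thesis
    unfolding step_classes_iff[OF assms(1)] by blast
qed

lemma lift_class_inj:
  assumes "K \<le> m" "C \<in> step_classes K" "D \<in> step_classes K" "lift_class m C = lift_class m D"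
  shows "C = D"
proof -
  have "lift_class m C \<noteq> {}"
    using lift_class_closed[OF assms(1,2)] step_classes_iff[OF assms(1), of "lift_class m C"] by auto
  then obtain x where "x \<in> lift_class m C" "x \<in> lift_class m D" using assms(4) by auto
  then show ?thesis
    using closed_classes_eqI[OF step_subset[OF K_pos] assms(2,3), of "take K x"]
    by (simp add: lift_class_def)
qed

text \<open>The newest windows of \<open>R\<close> form a closed skeleton class \<open>C\<close>. It
  then suffices that \<open>R\<close> and the lift of \<open>C\<close> share an element.\<close>

lemma lift_class_surj:
  assumes "K \<le> m" "R \<in> step_classes m"
  shows "\<exists>C\<in>step_classes K. R = lift_class m C"
proof -
  have R: "R \<noteq> {}" "R \<subseteq> words A m" "R \<times> R \<subseteq> (step m)\<^sup>*" "(step m)\<^sup>* `` R \<subseteq> R"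
    using assms step_classes_iff[of m] by auto
  define C where "C = drop (m - K) ` R"
  have "C \<subseteq> words A K"
    using R(2) assms(1) drop_in_words by (auto simp: C_def)
  moreover have "C \<times> C \<subseteq> (step K)\<^sup>*"
  proof clarify
    fix u v assume "u \<in> C" "v \<in> C"
    then obtain x y where xy: "x \<in> R" "y \<in> R" "u = drop (m - K) x" "v = drop (m - K) y"
      by (auto simp: C_def)
    then obtain t where "(x, y) \<in> step m ^^ t"
      using R(3) by (auto simp: rtrancl_is_UN_relpow)
    then show "(u, v) \<in> (step K)\<^sup>*"
      using xy R(2) assms(1) by (auto intro!: relpow_imp_rtrancl step_project)
  qed
  moreover have "(step K)\<^sup>* `` C \<subseteq> C"
  proof clarify
    fix u v assume "u \<in> C" "(u, v) \<in> (step K)\<^sup>*"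
    then obtain x t where x: "x \<in> R" "u = drop (m - K) x" and "(u, v) \<in> step K ^^ t"
      by (auto simp: C_def rtrancl_is_UN_relpow)
    then obtain y where "(x, y) \<in> step m ^^ t" "drop (m - K) y = v"
      using step_lift[OF assms(1)] R(2) by blast
    then show "v \<in> C"
      using R(4) x by (auto simp: C_def dest: relpow_imp_rtrancl)
  qed
  ultimately have C: "C \<in> step_classes K"
    using R(1) by (simp add: step_classes_iff C_def)
  \<comment> \<open>The common element: \<open>m - K\<close> steps from \<open>x\<close> lead to an
    admissible word of \<open>R\<close> that starts with the last window of
    \<open>x\<close>.\<close>
  obtain x where x: "x \<in> R" using R(1) by auto
  then obtain y where y: "(x, y) \<in> step m ^^ (m - K)"
    using relpow_step_total[OF assms(1)] R(2) by blast
  then have yR: "y \<in> R"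
    using R(4) x by (auto dest: relpow_imp_rtrancl)
  then have "y \<in> lift_class m C"
    using step_fill[OF assms(1) _ y] x R(2) by (auto simp: lift_class_def C_def)
  then have "R = lift_class m C"
    using closed_classes_eqI[OF step_subset assms(2) lift_class_closed[OF assms(1) C] yR]
      K_pos assms(1) by auto
  with C show ?thesis by blast
qed

text \<open>Cycles at \<open>take K x\<close> give one divisibility, through closed paths at
  \<open>x\<close> from \<open>step_reach\<close>. The other comes from projecting closed paths at
  \<open>x\<close> to cycles at \<open>drop (m - K) x\<close>. Both windows lie in \<open>C\<close>
  and have the same period.\<close>

lemma lift_class_period:
  assumes "K \<le> m" "C \<in> step_classes K"
  shows "class_period (\<lambda>t x y. (x, y) \<in> step K ^^ t) C =
    class_period (\<lambda>t x y. (x, y) \<in> step m ^^ t) (lift_class m C)"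
proof -
  have R: "lift_class m C \<in> step_classes m" by (rule lift_class_closed[OF assms])
  then obtain x where x: "x \<in> lift_class m C"
    using step_classes_iff[OF assms(1), of "lift_class m C"] by auto
  then have xm: "x \<in> words A m" "admissible x" and u: "take K x \<in> C"
    by (auto simp: lift_class_def)
  let ?u = "take K x" and ?v = "drop (m - K) x"
  have C: "C \<times> C \<subseteq> (step K)\<^sup>*" "(step K)\<^sup>* `` C \<subseteq> C"
    using assms(2) step_classes_iff[of K] by auto
  have uv: "(?u, ?v) \<in> step K ^^ (m - K)" by (rule step_spell[OF assms(1) xm])
  then have v: "?v \<in> C" using C(2) u by (auto dest: relpow_imp_rtrancl)
  then obtain l where l: "(?v, ?u) \<in> step K ^^ l"
    using C(1) u by (auto simp: rtrancl_is_UN_relpow)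
  have "period (step m) x dvd n" if n: "(?u, ?u) \<in> step K ^^ n" for n
  proof -
    have "period (step m) x dvd l + (m - K)" "period (step m) x dvd l + n + (m - K)"
      by (intro period_dvd step_reach assms(1) xm l relpow_trans[OF l n])+
    then have "period (step m) x dvd (l + n + (m - K)) - (l + (m - K))"
      by (rule dvd_diff_nat[rotated])
    then show ?thesis by simp
  qed
  then have "period (step m) x dvd period (step K) ?u"
    unfolding period_def[of "step K"] by (intro Gcd_greatest) auto
  moreover have "period (step K) ?v dvd n" if "(x, x) \<in> step m ^^ n" for n
    by (rule period_dvd[OF step_project[OF assms(1) xm(1) that]])
  then have "period (step K) ?v dvd period (step m) x"
    unfolding period_def[of "step m"] by (intro Gcd_greatest) auto
  moreover have "class_period (\<lambda>t x y. (x, y) \<in> step K ^^ t) C = period (step K) w" if "w \<in> C" for w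
    using class_period_eq[OF step_subset assms(2) that] K_pos by simp
  moreover have "class_period (\<lambda>t x y. (x, y) \<in> step m ^^ t) (lift_class m C) = period (step m) x"
    using class_period_eq[OF step_subset R x] K_pos assms(1) by simp
  ultimately show ?thesis
    using u v by (metis dvd_antisym)
qed

end

section \<open>The skeleton of a kernel\<close>

lemma finite_words: "finite A \<Longrightarrow> finite (words A n)"
  by (simp add: words_def finite_lists_length_eq)

lemma seg_drop: "length x = m \<Longrightarrow> 1 \<le> i \<Longrightarrow> i \<le> Suc m \<Longrightarrow> seg x i m = drop (i - 1) x"
  by (simp add: seg_def)

lemma seg_tl: "length x = m \<Longrightarrow> 1 \<le> m \<Longrightarrow> seg x 2 m = tl x"
  by (simp add: seg_def drop_Suc)

locale kernel =
  fixes A :: "'a set" and m :: nat and p :: "'a list \<Rightarrow> 'a \<Rightarrow> real"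
  assumes finite_A: "finite A" and A_nonempty: "A \<noteq> {}" and m_pos: "1 \<le> m"
    and kernel: "transition_kernel A m p"
begin

abbreviation K where "K \<equiv> skeleton_order A m p"

definition allowed :: "'a list \<Rightarrow> 'a \<Rightarrow> bool" where
  "allowed u a \<longleftrightarrow> (\<forall>y\<in>words A (m - K). p (y @ u) a > 0)"

lemma words_nonempty: "words A n \<noteq> {}"
proof -
  obtain a where "a \<in> A" using A_nonempty by auto
  then have "replicate n a \<in> words A n" by (auto simp: words_def)
  then show ?thesis by auto
qed

text \<open>The minimum is attained because at \<open>m - 1\<close> the padding is empty and the
  alternative only says that \<open>p x a\<close> is zero or positive.\<close>

lemma tau_property:
  assumes "x \<in> words A m" "a \<in> A"
  defines "i \<equiv> skeleton_tau A m p x a"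
  shows "i \<le> m - 1"
    and "(\<forall>y\<in>words A (m - i - 1). p (y @ drop (m - i - 1) x) a = 0) \<or>
         (\<forall>y\<in>words A (m - i - 1). p (y @ drop (m - i - 1) x) a > 0)"
proof -
  let ?P = "\<lambda>i. (\<forall>y\<in>words A (m - i - 1). p (y @ seg x (m - i) m) a = 0) \<or>
                (\<forall>y\<in>words A (m - i - 1). p (y @ seg x (m - i) m) a > 0)"
  have "p x a = 0 \<or> p x a > 0"
    using kernel assms(1,2) unfolding transition_kernel_def by fastforce
  then have P: "?P (m - 1)"
    using assms(1) m_pos by (auto simp: words_def seg_drop)
  show i: "i \<le> m - 1"
    unfolding i_def skeleton_tau_def by (rule Least_le[of ?P, OF P])
  have "?P i"
    unfolding i_def skeleton_tau_def by (rule LeastI[of ?P, OF P])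
  moreover have "seg x (m - i) m = drop (m - i - 1) x"
    using assms(1) i m_pos by (intro seg_drop) (auto simp: words_def)
  ultimately show "(\<forall>y\<in>words A (m - i - 1). p (y @ drop (m - i - 1) x) a = 0) \<or>
         (\<forall>y\<in>words A (m - i - 1). p (y @ drop (m - i - 1) x) a > 0)"
    by simp
qed

text \<open>The suprema run over nonempty finite sets, so they are least upper bounds even on the
  naturals.\<close>

lemma K_bounds: "1 \<le> K" "K \<le> m"
  and tau_less_K: "x \<in> words A m \<Longrightarrow> a \<in> A \<Longrightarrow> skeleton_tau A m p x a < K"
proof -
  show "1 \<le> K" by (simp add: skeleton_order_def)
  have inner: "(SUP a\<in>A. skeleton_tau A m p x a) \<le> m - 1" if "x \<in> words A m" for x
    using A_nonempty tau_property(1)[OF that] by (intro cSUP_least)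
  then have "(SUP x\<in>words A m. SUP a\<in>A. skeleton_tau A m p x a) \<le> m - 1"
    by (rule cSUP_least[OF words_nonempty])
  then show "K \<le> m" using m_pos by (simp add: skeleton_order_def)
  assume x: "x \<in> words A m" and a: "a \<in> A"
  have "skeleton_tau A m p x a \<le> (SUP a\<in>A. skeleton_tau A m p x a)"
    using a finite_A by (intro cSUP_upper) auto
  also have "\<dots> \<le> (SUP x\<in>words A m. SUP a\<in>A. skeleton_tau A m p x a)"
    using x finite_words[OF finite_A]
    by (intro cSUP_upper[of x _ "\<lambda>x. SUP a\<in>A. skeleton_tau A m p x a"]) auto
  finally show "skeleton_tau A m p x a < K" by (simp add: skeleton_order_def)
qed

text \<open>Positivity of \<open>p _ a\<close> is constant on the words sharing the last
  \<open>skeleton_tau A m p x a + 1\<close> letters with \<open>x\<close>. This number is at most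
  \<open>K\<close>, so words sharing the last \<open>K\<close> letters are among them.\<close>

lemma positive_iff_allowed:
  assumes "x \<in> words A m" "a \<in> A"
  shows "p x a > 0 \<longleftrightarrow> allowed (drop (m - K) x) a"
proof -
  define i where "i = skeleton_tau A m p x a"
  have i: "m - K \<le> m - i - 1" using tau_less_K[OF assms] by (simp add: i_def)
  have const: "(\<forall>y\<in>words A (m - i - 1). p (y @ drop (m - i - 1) x) a = 0) \<or>
      (\<forall>y\<in>words A (m - i - 1). p (y @ drop (m - i - 1) x) a > 0)"
    unfolding i_def by (rule tau_property(2)[OF assms])
  have "p x a > 0 \<longleftrightarrow> p (y @ drop (m - K) x) a > 0" if y: "y \<in> words A (m - K)" for y
  proof -
    define x' where "x' = y @ drop (m - K) x"
    have x': "x' \<in> words A m"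
      using y assms(1) K_bounds by (auto simp: x'_def words_def dest: in_set_dropD)
    \<comment> \<open>\<open>k\<close> counts those of the last \<open>K\<close> letters that may
      still vary without affecting positivity.\<close>
    obtain k where k: "m - i - 1 = k + (m - K)"
      using i by (metis le_Suc_ex add.commute)
    have "drop (m - i - 1) x' = drop (m - i - 1) x"
      using y unfolding k by (simp add: x'_def words_def)
    moreover have "take (m - i - 1) z \<in> words A (m - i - 1)" if "z \<in> words A m" for z
      using that by (auto simp: words_def dest: in_set_takeD)
    ultimately show ?thesis
      using const assms(1) x' unfolding x'_def[symmetric]
      by (metis append_take_drop_id order_less_irrefl)
  qed
  then show ?thesis
    unfolding allowed_def using words_nonempty[of "m - K"] by blast
qed

sublocale window_chain A K allowed
proof
  show "1 \<le> K" by (rule K_bounds)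
  fix u assume u: "u \<in> words A K"
  obtain y where "y \<in> words A (m - K)" using words_nonempty by blast
  then have x: "y @ u \<in> words A m" and d: "drop (m - K) (y @ u) = u"
    using u K_bounds by (auto simp: words_def)
  \<comment> \<open>Totality: a row with sum 1 has a positive entry.\<close>
  have "(\<Sum>a\<in>A. p (y @ u) a) > 0"
    using kernel x unfolding transition_kernel_def by simp
  then obtain a where "a \<in> A" "p (y @ u) a > 0"
    by (meson not_less sum_nonpos)
  then show "\<exists>a\<in>A. allowed u a"
    using positive_iff_allowed[OF x] d by auto
qed

section \<open>The two matrices as step relations\<close>

lemma skeleton_matrix_nonzero_iff:
  "skeleton_matrix A m p u v \<noteq> 0 \<longleftrightarrow>
    u \<in> words A K \<and> (\<exists>a\<in>A. v = tl u @ [a] \<and> allowed u a)"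
proof -
  have "seg x 1 K = x" "seg x 2 K = tl x" if "x \<in> words A K" for x
    using that K_bounds by (auto simp: words_def seg_drop seg_tl drop_Suc)
  then show ?thesis
    unfolding skeleton_matrix_def Let_def allowed_def by auto
qed

lemma binary_steps_skeleton:
  "binary_steps (words A K) (skeleton_matrix A m p) = (\<lambda>t x y. (x, y) \<in> step K ^^ t)"
proof -
  have "{(u, v). v \<in> words A K \<and> skeleton_matrix A m p u v \<noteq> 0} = step K"
    using step_subset[OF K_bounds(1)] unfolding skeleton_matrix_nonzero_iff
    by (auto simp: step_def)
  then show ?thesis
    by (simp only: binary_steps_eq_relpow[OF finite_words[OF finite_A]])
qed

lemma stochastic_steps_transition:
  "stochastic_steps (words A m) (transition_matrix A m p) = (\<lambda>t x y. (x, y) \<in> step m ^^ t)"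
proof -
  have tm: "transition_matrix A m p x y =
      (if x \<in> words A m \<and> (\<exists>a\<in>A. y = tl x @ [a]) then p x (last y) else 0)" for x y
    using m_pos by (auto simp: transition_matrix_def words_def seg_tl)
  have nonneg: "0 \<le> transition_matrix A m p x y" for x y
    unfolding tm using kernel by (auto simp: transition_kernel_def)
  have "{(x, y). y \<in> words A m \<and> transition_matrix A m p x y > 0} = step m"
    using step_subset[OF m_pos] positive_iff_allowed unfolding tm
    by (auto simp: step_def split: if_splits)
  then show ?thesis
    by (simp only: stochastic_steps_eq_relpow[OF finite_words[OF finite_A] nonneg])
qed

section \<open>Admissible words as products of skeleton entries\<close>

lemma skeleton_matrix_seg:
  assumes "x \<in> words A m" "1 \<le> j" "j \<le> m - K"
  shows "skeleton_matrix A m p (seg x j (j + K - 1)) (seg x (j + 1) (j + K)) \<noteq> 0 \<longleftrightarrow>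
    allowed (take K (drop (j - 1) x)) (x ! (j - 1 + K))"
proof -
  let ?u = "take K (drop (j - 1) x)" and ?b = "x ! (j - 1 + K)"
  have len: "length x = m" and set: "set x \<subseteq> A" using assms by (auto simp: words_def)
  have u: "?u \<in> words A K"
    using assms len set K_bounds by (auto simp: words_def dest!: in_set_takeD in_set_dropD)
  have b: "?b \<in> A"
    using assms len set K_bounds by (intro subsetD[OF set] nth_mem) auto
  have "seg x j (j + K - 1) = ?u"
    using assms K_bounds by (simp add: seg_def)
  moreover have "seg x (j + 1) (j + K) = tl ?u @ [?b]"
  proof -
    \<comment> \<open>Among these \<open>K + 1\<close> letters, the first \<open>K\<close> form the
      row index and the last \<open>K\<close> the column index.\<close>
    have "take (Suc K) (drop (j - 1) x) = ?u @ [?b]"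
      using assms len K_bounds by (subst take_Suc_conv_app_nth) auto
    then have "tl (take (Suc K) (drop (j - 1) x)) = tl (?u @ [?b])" by simp
    moreover have "tl (?u @ [?b]) = tl ?u @ [?b]"
      using u K_bounds by (intro tl_append2) (auto simp: words_def)
    moreover have "tl (take (Suc K) (drop (j - 1) x)) = take K (drop j x)"
      using assms by (simp add: tl_take tl_drop drop_Suc[symmetric] flip: drop_Suc)
    ultimately show ?thesis by (simp add: seg_def)
  qed
  ultimately show ?thesis
    unfolding skeleton_matrix_nonzero_iff using u b by auto
qed

lemma admissible_words_eq: "admissible_words A m p = {x \<in> words A m. admissible x}"
proof (cases "K = m")
  case True
  then have "admissible x" if "x \<in> words A m" for x
    using that by (intro admissible_short) (simp add: words_def)
  with True show ?thesis
    by (auto simp: admissible_words_def)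
next
  case False
  have "(\<Prod>j = 1..m - K. skeleton_matrix A m p (seg x j (j + K - 1)) (seg x (j + 1) (j + K))) = 1
      \<longleftrightarrow> admissible x" if x: "x \<in> words A m" for x
  proof -
    \<comment> \<open>Entries are 0 or 1, so the product is 1 exactly when no entry
      vanishes.\<close>
    have one: "skeleton_matrix A m p u v = 1 \<longleftrightarrow> skeleton_matrix A m p u v \<noteq> 0" for u v
      by (simp add: skeleton_matrix_def Let_def)
    have "(\<Prod>j = 1..m - K. skeleton_matrix A m p (seg x j (j + K - 1)) (seg x (j + 1) (j + K))) = 1
        \<longleftrightarrow> (\<forall>j\<in>{1..m - K}.
          skeleton_matrix A m p (seg x j (j + K - 1)) (seg x (j + 1) (j + K)) = 1)"
      by (rule prod_eq_1_iff[OF finite_atLeastAtMost])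
    also have "\<dots> \<longleftrightarrow> (\<forall>j\<in>{1..m - K}. allowed (take K (drop (j - 1) x)) (x ! (j - 1 + K)))"
      by (intro ball_cong refl) (simp only: one skeleton_matrix_seg[OF x] atLeastAtMost_iff)
    \<comment> \<open>Passes from positions counted from 1 to positions counted from 0.\<close>
    also have "\<dots> \<longleftrightarrow> (\<forall>j<m - K. allowed (take K (drop j x)) (x ! (j + K)))"
    proof (intro iffI ballI allI impI)
      fix j
      assume H: "\<forall>j\<in>{1..m - K}. allowed (take K (drop (j - 1) x)) (x ! (j - 1 + K))"
        and "j < m - K"
      then have "Suc j \<in> {1..m - K}" by simp
      with H show "allowed (take K (drop j x)) (x ! (j + K))" by fastforce
    next
      fix j
      assume H: "\<forall>j<m - K. allowed (take K (drop j x)) (x ! (j + K))" and "j \<in> {1..m - K}"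
      then have "j - 1 < m - K" by auto
      with H show "allowed (take K (drop (j - 1) x)) (x ! (j - 1 + K))" by blast
    qed
    also have "\<dots> \<longleftrightarrow> admissible x"
      using x K_bounds by (auto simp: admissible_def words_def less_diff_conv)
    finally show ?thesis .
  qed
  with False show ?thesis
    by (auto simp: admissible_words_def Let_def)
qed

lemma lift_class_eq:
  assumes "C \<subseteq> words A K"
  shows "lift_class m C =
    {y @ z | y z. y \<in> C \<and> z \<in> words A (m - K) \<and> y @ z \<in> admissible_words A m p}" (is "_ = ?R")
proof (intro equalityI subsetI)
  fix x assume "x \<in> lift_class m C"
  then have "take K x \<in> C" "drop K x \<in> words A (m - K)" "take K x @ drop K x \<in> admissible_words A m p"
    by (auto simp: lift_class_def admissible_words_eq words_def dest: in_set_dropD)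
  then have "take K x @ drop K x \<in> ?R" by blast
  then show "x \<in> ?R" by simp
next
  fix x assume "x \<in> ?R"
  then obtain y z where "x = y @ z" "y \<in> C" "x \<in> admissible_words A m p" by blast
  then show "x \<in> lift_class m C"
    using assms by (auto simp: lift_class_def admissible_words_eq words_def)
qed

end

section \<open>Recurrent classes of the Markov chain\<close>

theorem theorem1:
  fixes A :: "'a set" and m K N :: nat
    and W :: "'w measure" and X :: "nat \<Rightarrow> 'w \<Rightarrow> 'a"
    and p :: "'a list \<Rightarrow> 'a \<Rightarrow> real"
    and C :: "nat \<Rightarrow> 'a list set"
  assumes "finite A" and "m \<ge> 1"
    and "markov_chain_of_order W A m p X"
    and "K = skeleton_order A m p"
    and "N \<ge> 1"
    and "bij_betw C {1..N}
           (closed_classes (words A K) (binary_steps (words A K) (skeleton_matrix A m p)))"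
  shows "\<exists>R :: nat \<Rightarrow> 'a list set.
           bij_betw R {1..N} (recurrent_classes (words A m) (transition_matrix A m p)) \<and>
           (\<forall>i\<in>{1..N}.
              R i = {y @ z | y z. y \<in> C i \<and> z \<in> words A (m - K) \<and> y @ z \<in> admissible_words A m p} \<and>
              class_period (binary_steps (words A K) (skeleton_matrix A m p)) (C i) =
              class_period (stochastic_steps (words A m) (transition_matrix A m p)) (R i))"
proof -
  have prob: "prob_space W" and ker: "transition_kernel A m p"
    and meas: "X 0 \<in> measurable W (count_space A)"
    using assms(3) by (auto simp: markov_chain_of_order_def)
  \<comment> \<open>A probability space has a point, and \<open>X 0\<close> maps it into
    \<open>A\<close>.\<close>
  have "A \<noteq> {}"
    using measurable_space[OF meas] prob_space.not_empty[OF prob] by auto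
  then interpret kernel A m p
    using assms(1,2) ker by unfold_locales
  note K = assms(4) and Km = K_bounds(2)
  have C: "bij_betw C {1..N} (step_classes (skeleton_order A m p))"
    using assms(6) unfolding K binary_steps_skeleton .
  have "bij_betw (lift_class m) (step_classes (skeleton_order A m p)) (step_classes m)"
  proof (rule bij_betw_imageI)
    show "inj_on (lift_class m) (step_classes (skeleton_order A m p))"
      using lift_class_inj[OF Km] by (rule inj_onI)
    show "lift_class m ` step_classes (skeleton_order A m p) = step_classes m"
      using lift_class_closed[OF Km] lift_class_surj[OF Km] by fastforce
  qed
  \<comment> \<open>Lifting the given enumeration of skeleton classes enumerates the recurrent
    classes.\<close>
  then have "bij_betw (lift_class m \<circ> C) {1..N}
      (recurrent_classes (words A m) (transition_matrix A m p))"
    using bij_betw_trans[OF C] unfolding recurrent_classes_def stochastic_steps_transition by blast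
  moreover have "(lift_class m \<circ> C) i =
        {y @ z | y z. y \<in> C i \<and> z \<in> words A (m - K) \<and> y @ z \<in> admissible_words A m p} \<and>
      class_period (binary_steps (words A K) (skeleton_matrix A m p)) (C i) =
      class_period (stochastic_steps (words A m) (transition_matrix A m p)) ((lift_class m \<circ> C) i)"
    if "i \<in> {1..N}" for i
  proof -
    have Ci: "C i \<in> step_classes (skeleton_order A m p)"
      using C that by (auto simp: bij_betw_def)
    then have "C i \<subseteq> words A (skeleton_order A m p)"
      using step_classes_iff[OF order_refl] by blast
    then show ?thesis
      using lift_class_eq lift_class_period[OF Km Ci]
      unfolding K binary_steps_skeleton stochastic_steps_transition by simp
  qed
  ultimately show ?thesis by blast
qed

end
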